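(* Let $\theta\in\mathbb R$, $\mathcal A=\{(\lambda,\mu):\mu>\lambda>0\}$, and let $\sigma:\mathcal A\to(0,\infty)$ be a (measurable) time-scale function. (I) The function $$\kappa(\lambda,\mu,n)=\frac{\lambda^n\exp[2\theta(\lambda+\mu)]}{\mu^n\sigma(\lambda,\mu)},\qquad(\lambda,\mu,n)\in\mathcal A\times\mathbb Z_+,$$ satisfies the weak invariance equation (WIE, defined in the context) with the generator $$\begin{aligned}\mathbf R\phi(\lambda,\mu,n)=&\ \frac{\mu^n\sigma(\lambda,\mu)}{\lambda^n}\Big[\frac12\frac{\partial^2\phi}{\partial\lambda^2}+\frac12\frac{\partial^2\phi}{\partial\mu^2}+\theta\frac{\partial\phi}{\partial\lambda}+\theta\frac{\partial\phi}{\partial\mu}\Big](\lambda,\mu,n)\\&+\alpha(\lambda,\mu)\Big\{\lambda\big[\phi(\lambda,\mu,n+1)-\phi(\lambda,\mu,n)\big]+\mu\big[\phi(\lambda,\mu,n-1)-\phi(\lambda,\mu,n)\big]\mathbf 1(n\ge1)\Big\}.\end{aligned}$$ (II) If $\Xi:=\sum_{n\ge0}\int_{\mathcal A}\frac{\lambda^n\exp[2\theta(\lambda+\mu)]}{\mu^n\sigma(\lambda,\mu)}\,d\lambda\,d\mu<\infty$, then the normalized function $\kappa(\lambda,\mu,n)/\Xi$ is a probability density function on $\mathcal A\times\mathbb Z_+$ (relative to Lebesgue measure times counting measure).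
   Context: $\mathbb Z_+=\{0,1,2,\dots\}$; $\alpha(\lambda,\mu)>0$ is a given time-scale function. The setting is an $M/M/1/\infty$ queue whose pair (arrival rate $\lambda$, service rate $\mu$) performs a diffusion in $\mathcal A$ with unit diffusion matrix and drift $(\theta,\theta)$, reflected at the sides $\lambda=0$ and $\lambda=\mu$ along inward normals; $\mathbf R$ acts on functions $\phi$ that are $C^2$ in $(\lambda,\mu)$ with $\frac{\partial}{\partial\lambda}\phi(0+,\mu,n)=0$ and $\big(\frac{\partial}{\partial\lambda}-\frac{\partial}{\partial\mu}\big)\phi\big|_{\lambda=\mu}=0$. Definition (WIE). A function $\eta:\mathcal A\times\mathbb Z_+\to\mathbb R$ satisfies the WIE with generator $\mathbf R$ if, for all $(\lambda,\mu,n)\in\mathcal A\times\mathbb Z_+$, with $h(\lambda,\mu,n)=\frac{\mu^n\sigma(\lambda,\mu)}{\lambda^n}\eta(\lambda,\mu,n)$: (i) $\displaystyle\frac12\Big(\frac{\partial^2}{\partial\lambda^2}+\frac{\partial^2}{\partial\mu^2}\Big)h-\theta\Big(\frac{\partial}{\partial\lambda}+\frac{\partial}{\partial\mu}\Big)h=0$; and (ii) $\eta(\lambda,\mu,n)\big[\lambda+\mu\mathbf 1(n\ge1)\big]=\lambda\,\eta(\lambda,\mu,n-1)\mathbf 1(n\ge1)+\mu\,\eta(\lambda,\mu,n+1)$. *)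

theory Defs
  imports "HOL-Analysis.Analysis"
begin

(* Throughout, l is the arrival rate, m the service rate and n the queue length. *)

definition rate_domain :: "(real \<times> real) set" where
  "rate_domain = {(l, m). 0 < l \<and> l < m}"

definition D_arr :: "(real \<Rightarrow> real \<Rightarrow> real) \<Rightarrow> real \<Rightarrow> real \<Rightarrow> real" where
  "D_arr f l m = deriv (\<lambda>x. f x m) l"

definition D_srv :: "(real \<Rightarrow> real \<Rightarrow> real) \<Rightarrow> real \<Rightarrow> real \<Rightarrow> real" where
  "D_srv f l m = deriv (\<lambda>y. f l y) m"

definition C1_rate :: "(real \<Rightarrow> real \<Rightarrow> real) \<Rightarrow> bool" where
  "C1_rate f \<longleftrightarrow>
     (\<forall>(l, m) \<in> rate_domain.
        (\<lambda>x. f x m) field_differentiable at l \<and> (\<lambda>y. f l y) field_differentiable at m) \<and>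
     continuous_on rate_domain (\<lambda>(l, m). D_arr f l m) \<and>
     continuous_on rate_domain (\<lambda>(l, m). D_srv f l m)"

definition C2_rate :: "(real \<Rightarrow> real \<Rightarrow> real) \<Rightarrow> bool" where
  "C2_rate f \<longleftrightarrow> C1_rate f \<and> C1_rate (D_arr f) \<and> C1_rate (D_srv f)"

(* The reflection conditions at the sides l = 0 and l = m are read as limits from inside
   the open wedge. *)
definition generator_domain :: "(real \<Rightarrow> real \<Rightarrow> nat \<Rightarrow> real) set" where
  "generator_domain = {\<phi>. \<forall>n. C2_rate (\<lambda>l m. \<phi> l m n) \<and>
     (\<forall>m>0. ((\<lambda>l. D_arr (\<lambda>l m. \<phi> l m n) l m) \<longlongrightarrow> 0) (at_right 0)) \<and>
     (\<forall>r>0. ((\<lambda>(l, m). D_arr (\<lambda>l m. \<phi> l m n) l m - D_srv (\<lambda>l m. \<phi> l m n) l m) \<longlongrightarrow> 0)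
        (at (r, r) within rate_domain))}"

definition generator ::
  "real \<Rightarrow> (real \<Rightarrow> real \<Rightarrow> real) \<Rightarrow> (real \<Rightarrow> real \<Rightarrow> real) \<Rightarrow>
   (real \<Rightarrow> real \<Rightarrow> nat \<Rightarrow> real) \<Rightarrow> real \<Rightarrow> real \<Rightarrow> nat \<Rightarrow> real" where
  "generator \<theta> \<sigma> \<alpha> \<phi> l m n =
     (let f = (\<lambda>l m. \<phi> l m n) in
        m ^ n * \<sigma> l m / l ^ n *
          (1/2 * D_arr (D_arr f) l m + 1/2 * D_srv (D_srv f) l m
           + \<theta> * D_arr f l m + \<theta> * D_srv f l m)) +
     \<alpha> l m * (l * (\<phi> l m (n + 1) - \<phi> l m n)
       + m * (\<phi> l m (n - 1) - \<phi> l m n) * of_bool (n \<ge> 1))"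

definition generated_by ::
  "((real \<Rightarrow> real \<Rightarrow> nat \<Rightarrow> real) \<Rightarrow> real \<Rightarrow> real \<Rightarrow> nat \<Rightarrow> real) \<Rightarrow>
   real \<Rightarrow> (real \<Rightarrow> real \<Rightarrow> real) \<Rightarrow> (real \<Rightarrow> real \<Rightarrow> real) \<Rightarrow> bool" where
  "generated_by R \<theta> \<sigma> \<alpha> \<longleftrightarrow>
     (\<forall>(l, m) \<in> rate_domain. \<sigma> l m > 0 \<and> \<alpha> l m > 0) \<and>
     (\<forall>\<phi> \<in> generator_domain. \<forall>(l, m) \<in> rate_domain. \<forall>n. R \<phi> l m n = generator \<theta> \<sigma> \<alpha> \<phi> l m n)"

lemma D_radial:
  "D_arr (\<lambda>l m. l\<^sup>2 + m\<^sup>2) = (\<lambda>l m. 2 * l)"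
  "D_srv (\<lambda>l m. l\<^sup>2 + m\<^sup>2) = (\<lambda>l m. 2 * m)"
  "D_arr (\<lambda>l m. (l\<^sup>2 + m\<^sup>2)\<^sup>2) = (\<lambda>l m. 4 * l * (l\<^sup>2 + m\<^sup>2))"
  "D_srv (\<lambda>l m. (l\<^sup>2 + m\<^sup>2)\<^sup>2) = (\<lambda>l m. 4 * m * (l\<^sup>2 + m\<^sup>2))"
  "D_arr (\<lambda>l m. 2 * l) = (\<lambda>l m. 2)" "D_srv (\<lambda>l m. 2 * l) = (\<lambda>l m. 0)"
  "D_arr (\<lambda>l m. 2 * m) = (\<lambda>l m. 0)" "D_srv (\<lambda>l m. 2 * m) = (\<lambda>l m. 2)"
  "D_arr (\<lambda>l m. 4 * l * (l\<^sup>2 + m\<^sup>2)) = (\<lambda>l m. 12 * l\<^sup>2 + 4 * m\<^sup>2)"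
  "D_srv (\<lambda>l m. 4 * l * (l\<^sup>2 + m\<^sup>2)) = (\<lambda>l m. 8 * l * m)"
  "D_arr (\<lambda>l m. 4 * m * (l\<^sup>2 + m\<^sup>2)) = (\<lambda>l m. 8 * l * m)"
  "D_srv (\<lambda>l m. 4 * m * (l\<^sup>2 + m\<^sup>2)) = (\<lambda>l m. 4 * l\<^sup>2 + 12 * m\<^sup>2)"
  unfolding D_arr_def D_srv_def
  by (auto intro!: ext DERIV_imp_deriv derivative_eq_intros
      simp: power2_eq_square algebra_simps)

lemma radial_in_domain:
  "(\<lambda>l m n. l\<^sup>2 + m\<^sup>2) \<in> generator_domain"
  "(\<lambda>l m n. (l\<^sup>2 + m\<^sup>2)\<^sup>2) \<in> generator_domain"
  unfolding generator_domain_def C2_rate_def C1_rate_def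
  by (auto simp: D_radial case_prod_unfold
      intro!: derivative_intros continuous_intros tendsto_eq_intros)

(* R determines \<theta>, and \<sigma> on the wedge, which are the only coefficients entering the weak
   invariance equation; so the existential quantifier in satisfies_WIE leaves no freedom. *)
lemma generated_by_unique:
  assumes "generated_by R \<theta> \<sigma> \<alpha>" "generated_by R \<theta>' \<sigma>' \<alpha>'"
  shows "\<theta> = \<theta>'" and "(l, m) \<in> rate_domain \<Longrightarrow> \<sigma> l m = \<sigma>' l m"
proof -
  have *: "\<sigma> l m = \<sigma>' l m \<and> \<theta> = \<theta>'" if lm: "(l, m) \<in> rate_domain" for l m
  proof -
    let ?s = "\<sigma> l m" and ?s' = "\<sigma>' l m"
    have pos: "0 < l" "0 < m" "?s > 0" "?s' > 0"
      using lm assms unfolding generated_by_def by (auto simp: rate_domain_def)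
    have eq: "generator \<theta> \<sigma> \<alpha> \<phi> l m 0 = generator \<theta>' \<sigma>' \<alpha>' \<phi> l m 0"
      if "\<phi> \<in> generator_domain" for \<phi>
      using that assms lm unfolding generated_by_def by (metis (mono_tags, lifting) case_prodD)
    have 1: "?s * (2 + \<theta> * (2 * (l + m))) = ?s' * (2 + \<theta>' * (2 * (l + m)))"
      using eq[OF radial_in_domain(1)] unfolding generator_def Let_def D_radial
      by (simp add: algebra_simps)
    have "(?s * (8 + \<theta> * (4 * (l + m)))) * (l\<^sup>2 + m\<^sup>2)
        = (?s' * (8 + \<theta>' * (4 * (l + m)))) * (l\<^sup>2 + m\<^sup>2)"
      using eq[OF radial_in_domain(2)] unfolding generator_def Let_def D_radial
      by (simp add: algebra_simps)
    moreover have "l\<^sup>2 + m\<^sup>2 \<noteq> 0" using pos by (simp add: sum_power2_eq_zero_iff)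
    ultimately have 2: "?s * (8 + \<theta> * (4 * (l + m))) = ?s' * (8 + \<theta>' * (4 * (l + m)))"
      by (metis mult_cancel_right)
    have s: "?s = ?s'" using 1 2 by (simp add: algebra_simps)
    with 1 pos show ?thesis by simp
  qed
  show "\<theta> = \<theta>'" using *[of 1 2] by (simp add: rate_domain_def)
  show "(l, m) \<in> rate_domain \<Longrightarrow> \<sigma> l m = \<sigma>' l m" using * by blast
qed

definition satisfies_WIE ::
  "((real \<Rightarrow> real \<Rightarrow> nat \<Rightarrow> real) \<Rightarrow> real \<Rightarrow> real \<Rightarrow> nat \<Rightarrow> real) \<Rightarrow>
   (real \<Rightarrow> real \<Rightarrow> nat \<Rightarrow> real) \<Rightarrow> bool" where
  "satisfies_WIE R \<eta> \<longleftrightarrow> (\<exists>\<theta> \<sigma> \<alpha>. generated_by R \<theta> \<sigma> \<alpha> \<and>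
     (\<forall>n. let h = (\<lambda>l m. m ^ n * \<sigma> l m / l ^ n * \<eta> l m n) in
        C2_rate h \<and>
        (\<forall>(l, m) \<in> rate_domain.
           1/2 * (D_arr (D_arr h) l m + D_srv (D_srv h) l m)
             - \<theta> * (D_arr h l m + D_srv h l m) = 0 \<and>
           \<eta> l m n * (l + m * of_bool (n \<ge> 1))
             = l * \<eta> l m (n - 1) * of_bool (n \<ge> 1) + m * \<eta> l m (n + 1))))"

definition kappa ::
  "real \<Rightarrow> (real \<Rightarrow> real \<Rightarrow> real) \<Rightarrow> real \<Rightarrow> real \<Rightarrow> nat \<Rightarrow> real" where
  "kappa \<theta> \<sigma> l m n = l ^ n * exp (2 * \<theta> * (l + m)) / (m ^ n * \<sigma> l m)"

definition Xi :: "real \<Rightarrow> (real \<Rightarrow> real \<Rightarrow> real) \<Rightarrow> ennreal" where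
  "Xi \<theta> \<sigma> = (\<Sum>n. \<integral>\<^sup>+(l, m)\<in>rate_domain. ennreal (kappa \<theta> \<sigma> l m n) \<partial>lborel)"

definition state_measure :: "((real \<times> real) \<times> nat) measure" where
  "state_measure = restrict_space lborel rate_domain \<Otimes>\<^sub>M count_space UNIV"

definition is_pdf :: "'a measure \<Rightarrow> ('a \<Rightarrow> real) \<Rightarrow> bool" where
  "is_pdf M f \<longleftrightarrow> f \<in> borel_measurable M \<and> (\<forall>x \<in> space M. 0 \<le> f x) \<and>
     (\<integral>\<^sup>+x. ennreal (f x) \<partial>M) = 1"

end

theory Submission
  imports Defs
begin

text \<open>On the open wedge the weight in front of \<open>\<eta>\<close> cancels everything in \<open>kappa\<close> except
  \<open>exp (2 * \<theta> * (l + m))\<close>, which the differential operator annihilates; outside the wedge \<open>\<sigma>\<close> is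
  arbitrary, so the cancellation passes to derivatives only through locality. The balance equation
  holds because \<open>kappa\<close> is geometric in \<open>n\<close> with ratio \<open>l / m\<close>.\<close>

lemma open_rate_domain: "open rate_domain"
proof -
  have "rate_domain = {p. 0 < fst p} \<inter> {p. fst p < snd p}"
    by (auto simp: rate_domain_def)
  also have "open \<dots>"
    by (intro open_Int open_Collect_less continuous_intros)
  finally show ?thesis .
qed

text \<open>Both coordinate lines through the point are continuous curves, so the open wedge pulls
  back to a neighbourhood of the parameter. This is the form of openness that a one-variable
  derivative needs.\<close>

lemma eventually_rate_domain:
  assumes "(l, m) \<in> rate_domain"
  shows "eventually (\<lambda>x. (x, m) \<in> rate_domain) (nhds l)"
    and "eventually (\<lambda>y. (l, y) \<in> rate_domain) (nhds m)"
proof -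
  have *: "rate_domain \<in> Collect open" "(l, m) \<in> rate_domain"
    using assms open_rate_domain by auto
  have "((\<lambda>x. (x, m)) \<longlongrightarrow> (l, m)) (nhds l)" "((\<lambda>y. (l, y)) \<longlongrightarrow> (l, m)) (nhds m)"
    by (auto intro!: tendsto_intros filterlim_ident)
  with * show "eventually (\<lambda>x. (x, m) \<in> rate_domain) (nhds l)"
    and "eventually (\<lambda>y. (l, y) \<in> rate_domain) (nhds m)"
    by (auto dest: topological_tendstoD)
qed

context
  fixes f g :: "real \<Rightarrow> real \<Rightarrow> real"
  assumes eq: "\<And>l m. (l, m) \<in> rate_domain \<Longrightarrow> f l m = g l m"
begin

lemma
  assumes "(l, m) \<in> rate_domain"
  shows eventually_eq_arr: "eventually (\<lambda>x. f x m = g x m) (nhds l)"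
    and eventually_eq_srv: "eventually (\<lambda>y. f l y = g l y) (nhds m)"
  using eventually_rate_domain[OF assms] by (auto elim!: eventually_mono simp: eq)

lemma D_arr_cong: "(l, m) \<in> rate_domain \<Longrightarrow> D_arr f l m = D_arr g l m"
  unfolding D_arr_def by (intro deriv_cong_ev eventually_eq_arr refl)

lemma D_srv_cong: "(l, m) \<in> rate_domain \<Longrightarrow> D_srv f l m = D_srv g l m"
  unfolding D_srv_def by (intro deriv_cong_ev eventually_eq_srv refl)

text \<open>Differentiability at a wedge point depends only on the germ along each coordinate line.
  Continuity of the partial derivatives is required on the wedge alone, where those of
  \<open>f\<close> and \<open>g\<close> coincide.\<close>

lemma C1_rate_cong:
  assumes "C1_rate g"
  shows "C1_rate f"
proof -
  have "(\<lambda>x. f x m) field_differentiable at l" "(\<lambda>y. f l y) field_differentiable at m"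
    if lm: "(l, m) \<in> rate_domain" for l m
    using assms lm unfolding C1_rate_def field_differentiable_def
    by (auto simp: DERIV_cong_ev[OF refl eventually_eq_arr[OF lm] refl]
        DERIV_cong_ev[OF refl eventually_eq_srv[OF lm] refl])
  moreover have "continuous_on rate_domain (\<lambda>(l, m). D_arr f l m)
      = continuous_on rate_domain (\<lambda>(l, m). D_arr g l m)"
    "continuous_on rate_domain (\<lambda>(l, m). D_srv f l m)
      = continuous_on rate_domain (\<lambda>(l, m). D_srv g l m)"
    by (rule continuous_on_cong; auto simp: D_arr_cong D_srv_cong)+
  ultimately show ?thesis
    using assms unfolding C1_rate_def by auto
qed

end

lemma C2_rate_cong:
  assumes "\<And>l m. (l, m) \<in> rate_domain \<Longrightarrow> f l m = g l m" and "C2_rate g"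
  shows "C2_rate f"
  using assms unfolding C2_rate_def
  by (metis C1_rate_cong D_arr_cong D_srv_cong)

text \<open>The free constant \<open>c\<close> closes the family under both partial derivatives, so
  these two equations also evaluate all second derivatives.\<close>

lemma D_exp:
  "D_arr (\<lambda>l m. c * exp (k * (l + m))) = (\<lambda>l m. c * k * exp (k * (l + m)))"
  "D_srv (\<lambda>l m. c * exp (k * (l + m))) = (\<lambda>l m. c * k * exp (k * (l + m)))"
  unfolding D_arr_def D_srv_def
  by (auto intro!: ext DERIV_imp_deriv derivative_eq_intros)

lemma C1_rate_exp: "C1_rate (\<lambda>l m. c * exp (k * (l + m)))"
proof -
  have *: "((\<lambda>x. c * exp (k * (x + m))) has_field_derivative c * k * exp (k * (l + m))) (at l)"
    "((\<lambda>y. c * exp (k * (l + y))) has_field_derivative c * k * exp (k * (l + m))) (at m)"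
    for l m :: real
    by (auto intro!: derivative_eq_intros)
  show ?thesis
    unfolding C1_rate_def D_exp field_differentiable_def
    \<comment> \<open>The explicit \<open>P\<close> makes the derivative value the existential
      witness.\<close>
    by (auto simp: case_prod_unfold intro!: continuous_intros *[THEN exI[where P = "\<lambda>D. (_ has_field_derivative D) _"]])
qed

lemma C2_rate_exp: "C2_rate (\<lambda>l m. c * exp (k * (l + m)))"
  unfolding C2_rate_def D_exp by (intro conjI C1_rate_exp)

lemma kappa_balance:
  assumes "(l, m) \<in> rate_domain"
  shows "kappa \<theta> \<sigma> l m n * (l + m * of_bool (n \<ge> 1))
    = l * kappa \<theta> \<sigma> l m (n - 1) * of_bool (n \<ge> 1) + m * kappa \<theta> \<sigma> l m (n + 1)"
proof -
  have pos: "l > 0" "m > 0" using assms by (auto simp: rate_domain_def)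
  define c where "c = exp (2 * \<theta> * (l + m)) / \<sigma> l m"
  have *: "kappa \<theta> \<sigma> l m k = (l / m) ^ k * c" for k
    unfolding kappa_def c_def by (simp add: power_divide)
  show ?thesis
    \<comment> \<open>At \<open>n = 0\<close> the truncated \<open>n - 1\<close> is again
      \<open>0\<close>, but \<open>of_bool\<close> removes that term. For a successor, the common
      factor \<open>c\<close> and a power of \<open>l / m\<close> split off.\<close>
    unfolding * using pos by (cases n) (simp_all add: field_simps)
qed

lemma satisfies_WIE_kappa:
  assumes pos: "\<And>l m. (l, m) \<in> rate_domain \<Longrightarrow> \<sigma> l m > 0 \<and> \<alpha> l m > 0"
  shows "satisfies_WIE (generator \<theta> \<sigma> \<alpha>) (kappa \<theta> \<sigma>)"
proof -
  let ?h = "\<lambda>n l m. m ^ n * \<sigma> l m / l ^ n * kappa \<theta> \<sigma> l m n"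
  \<comment> \<open>The factor \<open>1\<close> gives the shape \<open>c * exp (k * (l + m))\<close>
    with \<open>k = 2 * \<theta>\<close>.\<close>
  let ?E = "\<lambda>l m. 1 * exp (2 * \<theta> * (l + m))"
  have gen: "generated_by (generator \<theta> \<sigma> \<alpha>) \<theta> \<sigma> \<alpha>"
    using pos by (auto simp: generated_by_def)
  have eq: "?h n l m = ?E l m" if "(l, m) \<in> rate_domain" for n l m
    using that pos[OF that] unfolding kappa_def rate_domain_def by auto
  have C2: "C2_rate (?h n)" for n
    by (rule C2_rate_cong[OF eq C2_rate_exp])
  have wie: "1/2 * (D_arr (D_arr (?h n)) l m + D_srv (D_srv (?h n)) l m)
      - \<theta> * (D_arr (?h n) l m + D_srv (?h n) l m) = 0"
    if lm: "(l, m) \<in> rate_domain" for n l m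
  proof -
    have arr: "D_arr (?h n) x y = D_arr ?E x y" and srv: "D_srv (?h n) x y = D_srv ?E x y"
      if "(x, y) \<in> rate_domain" for x y
      by (rule D_arr_cong[OF eq that] D_srv_cong[OF eq that], assumption)+
    \<comment> \<open>Locality is used a second time: \<open>arr\<close> and \<open>srv\<close> hold
      on the whole wedge, so the first derivatives are themselves functions that agree
      there.\<close>
    have arr2: "D_arr (D_arr (?h n)) l m = D_arr (D_arr ?E) l m"
      and srv2: "D_srv (D_srv (?h n)) l m = D_srv (D_srv ?E) l m"
      by (rule D_arr_cong[OF arr lm] D_srv_cong[OF srv lm], assumption)+
    show ?thesis
      \<comment> \<open>With \<open>k = 2 * \<theta>\<close> the coefficients cancel: half of
        \<open>k^2 + k^2\<close> equals \<open>\<theta> * (k + k)\<close>.\<close>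
      unfolding arr[OF lm] srv[OF lm] arr2 srv2 D_exp by (simp add: algebra_simps)
  qed
  show ?thesis
    unfolding satisfies_WIE_def Let_def
    \<comment> \<open>The witnesses are the parameters of the generator itself;
      \<open>generated_by_unique\<close> shows that \<open>\<theta>\<close>, and
      \<open>\<sigma>\<close> on the wedge, could not be chosen otherwise.\<close>
    by (rule exI[of _ \<theta>], rule exI[of _ \<sigma>], rule exI[of _ \<alpha>])
      (intro conjI allI ballI gen C2; clarify; intro conjI wie kappa_balance)
qed

text \<open>For fixed \<open>n\<close>, \<open>kappa\<close> is built by measurable operations from
  the coordinates and \<open>\<sigma>\<close>. The restricted space appears because
  \<open>\<sigma>\<close> is measurable by hypothesis only on the wedge.\<close>

lemma kappa_measurable:
  assumes "(\<lambda>(l, m). \<sigma> l m) \<in> borel_measurable (restrict_space borel rate_domain)"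
  shows "(\<lambda>p. kappa \<theta> \<sigma> (fst p) (snd p) n) \<in> borel_measurable (restrict_space lborel rate_domain)"
proof -
  have [measurable]: "(\<lambda>p. \<sigma> (fst p) (snd p)) \<in> borel_measurable (restrict_space lborel rate_domain)"
    using assms by (simp add: case_prod_unfold cong: measurable_cong_sets restrict_space_sets_cong)
  have [measurable]: "fst \<in> borel_measurable (restrict_space lborel rate_domain)"
    "snd \<in> borel_measurable (restrict_space lborel rate_domain)"
    by (auto intro!: measurable_restrict_space1 borel_measurable_continuous_onI continuous_intros)
  show ?thesis
    unfolding kappa_def by measurable
qed

text \<open>The term \<open>n = 0\<close> alone is the integral of a strictly positive function over
  a nonempty open set, which has positive Lebesgue measure. This rules out a division by zero in the
  normalized density.\<close>

lemma Xi_nonzero: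
  assumes pos: "\<And>l m. (l, m) \<in> rate_domain \<Longrightarrow> \<sigma> l m > 0"
    and meas: "(\<lambda>(l, m). \<sigma> l m) \<in> borel_measurable (restrict_space borel rate_domain)"
  shows "Xi \<theta> \<sigma> \<noteq> 0"
proof
  let ?f = "\<lambda>p. ennreal (kappa \<theta> \<sigma> (fst p) (snd p) 0) * indicator rate_domain p"
  have [measurable]: "rate_domain \<in> sets borel"
    using open_rate_domain by simp
  have f: "?f \<in> borel_measurable lborel"
    using kappa_measurable[OF meas]
    by (subst borel_measurable_restrict_space_iff_ennreal[symmetric]) auto
  assume "Xi \<theta> \<sigma> = 0"
  then have "(\<integral>\<^sup>+p. ?f p \<partial>lborel) = 0"
    unfolding Xi_def by (simp add: case_prod_unfold suminf_eq_zero_iff)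
  then have "AE p in lborel. ?f p = 0"
    by (simp add: nn_integral_0_iff_AE[OF f])
  moreover have "?f p \<noteq> 0" if "p \<in> rate_domain" for p
    using that pos[of "fst p" "snd p"] by (simp add: kappa_def)
  ultimately have "AE p in lborel. p \<notin> rate_domain"
    by (auto elim!: eventually_mono)
  then have "rate_domain \<in> null_sets lborel"
    by (simp add: AE_iff_null_sets)
  \<comment> \<open>A vanishing integral has made the wedge a null set, which contradicts its being
    open and containing \<open>(1, 2)\<close>.\<close>
  then have "negligible rate_domain"
    by (simp add: negligible_iff_null_sets null_sets_completionI)
  moreover have "(1, 2) \<in> rate_domain" by (simp add: rate_domain_def)
  ultimately show False
    using open_not_negligible open_rate_domain by blast
qed

text \<open>With a countable discrete second factor, a preimage is a countable union of slices, so
  measurability of each slice suffices.\<close>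

lemma measurable_pair_count_space:
  fixes f :: "'a \<Rightarrow> 'b::countable \<Rightarrow> 'c"
  assumes "\<And>n. (\<lambda>p. f p n) \<in> M \<rightarrow>\<^sub>M N"
  shows "(\<lambda>(p, n). f p n) \<in> M \<Otimes>\<^sub>M count_space UNIV \<rightarrow>\<^sub>M N"
  unfolding case_prod_unfold
  by (rule measurable_compose_countable[where f = "\<lambda>n x. f (fst x) n"])
    (auto intro: measurable_compose[OF measurable_fst assms])

text \<open>Tonelli with the rates integrated first: the outer integral over the counting measure is
  a series, in the form that defines \<open>Xi\<close>.\<close>

lemma nn_integral_state_measure:
  assumes f: "\<And>n. (\<lambda>p. f p n) \<in> borel_measurable (restrict_space lborel rate_domain)"
  shows "(\<lambda>(p, n). f p n) \<in> borel_measurable state_measure"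
    and "(\<integral>\<^sup>+(p, n). f p n \<partial>state_measure) = (\<Sum>n. \<integral>\<^sup>+p\<in>rate_domain. f p n \<partial>lborel)"
proof -
  have dom: "rate_domain \<in> sets lborel"
    using open_rate_domain by simp
  interpret R: sigma_finite_measure "restrict_space lborel rate_domain"
    by (intro sigma_finite_measure_restrict_space sigma_finite_lborel dom)
  interpret C: sigma_finite_measure "count_space (UNIV :: nat set)"
    by (rule sigma_finite_measure_count_space)
  interpret P: pair_sigma_finite "restrict_space lborel rate_domain" "count_space (UNIV :: nat set)" ..
  show meas: "(\<lambda>(p, n). f p n) \<in> borel_measurable state_measure"
    unfolding state_measure_def
    by (intro measurable_pair_count_space f)
  have "(\<integral>\<^sup>+(p, n). f p n \<partial>state_measure)
      = (\<integral>\<^sup>+n. \<integral>\<^sup>+p. f p n \<partial>restrict_space lborel rate_domain \<partial>count_space UNIV)"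
    using P.nn_integral_snd[of "\<lambda>(p, n). f p n"] meas
    by (simp add: state_measure_def)
  also have "\<dots> = (\<Sum>n. \<integral>\<^sup>+p\<in>rate_domain. f p n \<partial>lborel)"
    using dom by (simp add: nn_integral_count_space_nat nn_integral_restrict_space)
  finally show "(\<integral>\<^sup>+(p, n). f p n \<partial>state_measure) = (\<Sum>n. \<integral>\<^sup>+p\<in>rate_domain. f p n \<partial>lborel)" .
qed

theorem theorem5p3:
  fixes \<theta> :: real and \<sigma> \<alpha> :: "real \<Rightarrow> real \<Rightarrow> real"
  assumes \<sigma>_pos: "\<And>l m. (l, m) \<in> rate_domain \<Longrightarrow> \<sigma> l m > 0"
    and \<alpha>_pos: "\<And>l m. (l, m) \<in> rate_domain \<Longrightarrow> \<alpha> l m > 0"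
    and \<sigma>_meas: "(\<lambda>(l, m). \<sigma> l m) \<in> borel_measurable (restrict_space borel rate_domain)"
  shows "satisfies_WIE (generator \<theta> \<sigma> \<alpha>) (kappa \<theta> \<sigma>) \<and>
    (Xi \<theta> \<sigma> < \<infinity> \<longrightarrow>
      is_pdf state_measure (\<lambda>((l, m), n). kappa \<theta> \<sigma> l m n / enn2real (Xi \<theta> \<sigma>)))"
proof (intro conjI impI)
  show "satisfies_WIE (generator \<theta> \<sigma> \<alpha>) (kappa \<theta> \<sigma>)"
    using \<sigma>_pos \<alpha>_pos by (intro satisfies_WIE_kappa) auto
next
  assume fin: "Xi \<theta> \<sigma> < \<infinity>"
  define X where "X = enn2real (Xi \<theta> \<sigma>)"
  have X: "Xi \<theta> \<sigma> = ennreal X" and X_pos: "X > 0"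
    \<comment> \<open>Finiteness and nonvanishing together make \<open>Xi\<close> a positive real,
      so \<open>enn2real\<close> loses nothing.\<close>
    using fin Xi_nonzero[OF \<sigma>_pos \<sigma>_meas, of \<theta>]
    by (auto simp: X_def enn2real_positive_iff zero_less_iff_neq_zero)
  let ?k = "\<lambda>p n. kappa \<theta> \<sigma> (fst p) (snd p) n"
  have k_meas: "(\<lambda>p. ?k p n) \<in> borel_measurable (restrict_space lborel rate_domain)" for n
    by (rule kappa_measurable[OF \<sigma>_meas])
  have meas: "(\<lambda>(p, n). ?k p n / X) \<in> borel_measurable state_measure"
    unfolding state_measure_def
    by (intro measurable_pair_count_space borel_measurable_divide k_meas borel_measurable_const)
  have nonneg: "0 \<le> kappa \<theta> \<sigma> l m n" if "(l, m) \<in> rate_domain" for l m n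
    using that \<sigma>_pos[OF that] by (simp add: kappa_def rate_domain_def)
  have space: "space state_measure = rate_domain \<times> UNIV"
    by (simp add: state_measure_def space_pair_measure space_restrict_space)
  have "(\<integral>\<^sup>+(p, n). ennreal (?k p n / X) \<partial>state_measure)
      = (\<integral>\<^sup>+(p, n). ennreal (?k p n) / ennreal X \<partial>state_measure)"
    \<comment> \<open>\<open>ennreal\<close> commutes with the quotient for a nonnegative numerator;
      the sign of \<open>kappa\<close> is known on the wedge, hence the appeal to
      \<open>space\<close>.\<close>
    using X_pos by (intro nn_integral_cong) (clarsimp simp: space nonneg divide_ennreal)
  also have "\<dots> = (\<integral>\<^sup>+(p, n). ennreal (?k p n) \<partial>state_measure) / ennreal X"
    using nn_integral_state_measure(1)[of "\<lambda>p n. ennreal (?k p n)"] k_meas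
    by (simp add: case_prod_unfold nn_integral_divide)
  also have "(\<integral>\<^sup>+(p, n). ennreal (?k p n) \<partial>state_measure) = Xi \<theta> \<sigma>"
    using k_meas by (subst nn_integral_state_measure(2)) (auto simp: Xi_def case_prod_unfold)
  also have "Xi \<theta> \<sigma> / ennreal X = 1"
    using X X_pos by (simp add: divide_ennreal)
  finally have "(\<integral>\<^sup>+(p, n). ennreal (?k p n / X) \<partial>state_measure) = 1" .
  moreover have "\<forall>x\<in>space state_measure. 0 \<le> (case x of (p, n) \<Rightarrow> ?k p n / X)"
    using nonneg X_pos by (clarsimp simp: space)
  ultimately show "is_pdf state_measure (\<lambda>((l, m), n). kappa \<theta> \<sigma> l m n / enn2real (Xi \<theta> \<sigma>))"
    unfolding is_pdf_def X_def[symmetric] using meas by (simp add: case_prod_unfold)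
qed

end
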